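(* Let $\boldsymbol{A}\in\mathbb{R}^{n\times d}$ be nonzero with $n>d$, let $\boldsymbol{b}\in\mathbb{R}^n$, let $\boldsymbol{x}_\star=\boldsymbol{A}^+\boldsymbol{b}$, and let $\kappa_{\rm dem}=\|\boldsymbol{A}^+\|\,\|\boldsymbol{A}\|_{\rm F}$. Let $\boldsymbol{x}_0\in\operatorname{range}(\boldsymbol{A}^\top)$, let $0\le t_{\rm b}<t$ be integers, let $\boldsymbol{x}_0,\boldsymbol{x}_1,\boldsymbol{x}_2,\ldots$ be the randomized Kaczmarz iterates for $(\boldsymbol{A},\boldsymbol{b})$ started at $\boldsymbol{x}_0$, and let $$\overline{\boldsymbol{x}}_t=\frac{1}{t-t_{\rm b}}\sum_{s=t_{\rm b}}^{t-1}\boldsymbol{x}_s$$ be the tail-averaged randomized Kaczmarz (TARK) estimator. Then $$\mathbb{E}\,\|\overline{\boldsymbol{x}}_t-\boldsymbol{x}_\star\|^2\le \frac{2\kappa_{\rm dem}^2-1}{t-t_{\rm b}}\left[\frac{\kappa_{\rm dem}^2\,\bigl(1-\kappa_{\rm dem}^{-2}\bigr)^{t_{\rm b}}}{t-t_{\rm b}}\,\|\boldsymbol{x}_0-\boldsymbol{x}_\star\|^2+\|\boldsymbol{A}^+\|^2\,\|\boldsymbol{b}-\boldsymbol{A}\boldsymbol{x}_\star\|^2\right].$$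
   Context: $\|\cdot\|$ is the $\ell_2$ norm of a vector or the spectral norm of a matrix, $\|\cdot\|_{\rm F}$ is the Frobenius norm, and $\boldsymbol{A}^+$ is the Moore–Penrose pseudoinverse. $\boldsymbol{a}_i^\top$ is the $i$th row of $\boldsymbol{A}$ and $b_i$ the $i$th entry of $\boldsymbol{b}$. The randomized Kaczmarz (RK) iteration, started at a fixed (deterministic) $\boldsymbol{x}_0$, is: for $t=0,1,2,\ldots$, independently sample an index $i_t\in\{1,\ldots,n\}$ with $\mathbb{P}\{i_t=i\}=\|\boldsymbol{a}_i\|^2/\|\boldsymbol{A}\|_{\rm F}^2$ (so zero rows are never selected, almost surely) and set $$\boldsymbol{x}_{t+1}=\boldsymbol{x}_t+\frac{b_{i_t}-\boldsymbol{a}_{i_t}^\top\boldsymbol{x}_t}{\|\boldsymbol{a}_{i_t}\|^2}\,\boldsymbol{a}_{i_t}.$$ The expectation is over the random indices. The convention $0^0=1$ is used. *)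

theory Defs
  imports "HOL-Probability.Probability"
begin

definition is_pseudoinverse :: "real ^ 'd ^ 'n \<Rightarrow> real ^ 'n ^ 'd \<Rightarrow> bool" where
  "is_pseudoinverse A P \<longleftrightarrow>
     A ** P ** A = A \<and> P ** A ** P = P \<and>
     transpose (A ** P) = A ** P \<and> transpose (P ** A) = P ** A"

definition pinv :: "real ^ 'd ^ 'n \<Rightarrow> real ^ 'n ^ 'd" where
  "pinv A = (THE P. is_pseudoinverse A P)"

lemma is_pseudoinverse_unique:
  fixes A :: "real ^ 'd ^ 'n"
  assumes "is_pseudoinverse A P" "is_pseudoinverse A Q"
  shows "P = Q"
proof -
  note P = assms(1)[unfolded is_pseudoinverse_def]
  note Q = assms(2)[unfolded is_pseudoinverse_def]
  have "A ** P = (A ** Q) ** (A ** P)"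
    using Q by (metis matrix_mul_assoc)
  then have "transpose (A ** P) = transpose (A ** P) ** transpose (A ** Q)"
    by (metis matrix_transpose_mul)
  then have AP: "A ** P = A ** Q"
    using P Q by (metis matrix_mul_assoc)
  have "P ** A = (P ** A) ** (Q ** A)"
    using Q by (metis matrix_mul_assoc)
  then have "transpose (P ** A) = transpose (Q ** A) ** transpose (P ** A)"
    by (metis matrix_transpose_mul)
  then have PA: "P ** A = Q ** A"
    using P Q by (metis matrix_mul_assoc)
  have "P = P ** (A ** P)"
    using P by (simp add: matrix_mul_assoc)
  also have "\<dots> = (P ** A) ** Q"
    by (simp add: AP matrix_mul_assoc)
  also have "\<dots> = Q"
    using Q by (simp add: PA)
  finally show ?thesis .
qed

lemma is_pseudoinverse_exists:
  fixes A :: "real ^ 'd ^ 'n"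
  shows "\<exists>P. is_pseudoinverse A P"
proof -
  define S where "S = range (\<lambda>y. transpose A *v y)"
  have subS: "subspace S"
    unfolding S_def by (intro linear_subspace_image) auto
  have adj: "(A *v x) \<bullet> y = x \<bullet> (transpose A *v y)" for x :: "real ^ 'd" and y
    by (metis dot_lmul_matrix inner_commute transpose_matrix_vector)
  have adjT: "(transpose A *v y) \<bullet> x = y \<bullet> (A *v x)" for x :: "real ^ 'd" and y
    by (metis adj inner_commute)
  have ker: "A *v z = 0 \<longleftrightarrow> (\<forall>s\<in>S. z \<bullet> s = 0)" for z
  proof -
    have "(\<forall>s\<in>S. z \<bullet> s = 0) \<longleftrightarrow> (\<forall>y. (A *v z) \<bullet> y = 0)"
      unfolding S_def adj by blast
    then show ?thesis by (metis inner_eq_zero_iff inner_zero_left)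
  qed
  have kerT: "A *v z = 0" if "transpose A *v (A *v z) = 0" for z
    using that adj[of z "A *v z"] by simp
  have ex: "\<exists>s\<in>S. transpose A *v (A *v s - b) = 0" for b
  proof -
    have subR: "subspace (range (\<lambda>x. A *v x))"
      by (intro linear_subspace_image) auto
    obtain u v where uv: "u \<in> span (range (\<lambda>x. A *v x))"
        "\<And>w. w \<in> span (range (\<lambda>x. A *v x)) \<Longrightarrow> orthogonal v w" "b = u + v"
      using orthogonal_subspace_decomp_exists[of "range (\<lambda>x. A *v x)" b] by metis
    then obtain x where x: "u = A *v x"
      using subR by (metis (no_types, lifting) imageE span_eq_iff)
    obtain s z where sz: "s \<in> span S" "\<And>w. w \<in> span S \<Longrightarrow> orthogonal z w" "x = s + z"
      using orthogonal_subspace_decomp_exists[of S x] by metis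
    have sS: "s \<in> S" using sz(1) subS by (metis span_eq_iff)
    have "A *v z = 0"
      using sz(2) unfolding ker by (auto simp: orthogonal_def span_base)
    then have "A *v s = u" by (simp add: x sz(3) matrix_vector_right_distrib)
    then have e: "A *v s - b = - v" by (simp add: uv(3))
    have "(transpose A *v v) \<bullet> y = 0" for y
      using uv(2)[of "A *v y"] by (simp add: dot_lmul_matrix orthogonal_def span_base)
    then have "transpose A *v v = 0" by (metis inner_eq_zero_iff)
    then have "transpose A *v (A *v s - b) = 0"
      unfolding e using matrix_vector_mult_diff_distrib[of "transpose A" 0 v]
      by (simp del: transpose_matrix_vector)
    with sS show ?thesis by blast
  qed
  have uniq: "s = s'"
    if "s \<in> S" "s' \<in> S" "transpose A *v (A *v s - b) = 0" "transpose A *v (A *v s' - b) = 0"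
    for s s' b
  proof -
    have "transpose A *v (A *v (s - s')) = 0"
      using that(3,4) by (simp add: matrix_vector_mult_diff_distrib)
    then have "A *v (s - s') = 0" by (rule kerT)
    moreover have "s - s' \<in> S" using that subS by (simp add: subspace_diff)
    ultimately have "(s - s') \<bullet> (s - s') = 0" using ker by blast
    then show ?thesis by simp
  qed
  obtain g where g: "\<And>b. g b \<in> S" "\<And>b. transpose A *v (A *v g b - b) = 0"
    using ex by metis
  have g_eq: "g b = s" if "s \<in> S" "transpose A *v (A *v s - b) = 0" for s b
    using uniq[OF g(1) that(1) g(2) that(2)] .
  have lin: "linear g"
  proof (rule linearI)
    fix x y
    show "g (x + y) = g x + g y"
      using g[of x] g[of y] subS
      by (intro g_eq) (auto simp: subspace_add matrix_vector_mult_diff_distrib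
            matrix_vector_right_distrib)
  next
    fix c x
    show "g (c *\<^sub>R x) = c *\<^sub>R g x"
      using g[of x] subS
      by (intro g_eq) (auto simp: subspace_scale matrix_vector_mult_diff_distrib
            matrix_vector_mult_scaleR)
  qed
  define P where "P = matrix g"
  have P: "P *v b = g b" for b
    unfolding P_def using lin by (simp add: matrix_works)
  have orth: "(A *v g b - b) \<bullet> (A *v y) = 0" for b y
    using adjT[of "A *v g b - b" y] unfolding g(2)[of b] by simp
  have AgA: "A *v g (A *v x) = A *v x" for x
  proof -
    have "transpose A *v (A *v (g (A *v x) - x)) = 0"
      using g(2)[of "A *v x"] by (simp add: matrix_vector_mult_diff_distrib)
    from kerT[OF this] show ?thesis by (simp add: matrix_vector_mult_diff_distrib)
  qed
  have gAS: "g (A *v s) = s" if "s \<in> S" for s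
    using that by (intro g_eq) auto
  have gA_orth: "(g (A *v x) - x) \<bullet> s = 0" if "s \<in> S" for x s
    using that AgA[of x] ker[of "g (A *v x) - x"]
    by (simp add: matrix_vector_mult_diff_distrib)
  have symI: "transpose M = M" if "\<And>x y. (M *v x) \<bullet> y = x \<bullet> (M *v y)"
    for M :: "real ^ 'k ^ 'k"
  proof -
    have "(transpose M *v x) \<bullet> y = (M *v x) \<bullet> y" for x y
      by (simp add: that dot_lmul_matrix)
    then have "transpose M *v x = M *v x" for x
      using vector_eq_rdot by blast
    then show ?thesis unfolding matrix_eq by blast
  qed
  have "is_pseudoinverse A P"
    unfolding is_pseudoinverse_def
  proof (intro conjI)
    show "A ** P ** A = A"
      unfolding matrix_eq matrix_vector_mul_assoc[symmetric] P AgA by blast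
    show "P ** A ** P = P"
      unfolding matrix_eq matrix_vector_mul_assoc[symmetric] P gAS[OF g(1)] by blast
    show "transpose (A ** P) = A ** P"
    proof (rule symI)
      fix x y
      have "(A *v g x) \<bullet> y = x \<bullet> (A *v g y)"
        using orth[of x "g y"] orth[of y "g x"]
        by (simp add: inner_diff_left inner_commute[of y] inner_commute[of "A *v g y"])
      then show "((A ** P) *v x) \<bullet> y = x \<bullet> ((A ** P) *v y)"
        unfolding matrix_vector_mul_assoc[symmetric] P .
    qed
    show "transpose (P ** A) = P ** A"
    proof (rule symI)
      fix x y
      have "g (A *v x) \<bullet> y = x \<bullet> g (A *v y)"
        using gA_orth[OF g(1)[of "A *v y"], of x] gA_orth[OF g(1)[of "A *v x"], of y]
        by (simp add: inner_diff_left inner_commute[of y] inner_commute[of "g (A *v y)"])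
      then show "((P ** A) *v x) \<bullet> y = x \<bullet> ((P ** A) *v y)"
        unfolding matrix_vector_mul_assoc[symmetric] P .
    qed
  qed
  then show ?thesis by blast
qed

lemma is_pseudoinverse_pinv: "is_pseudoinverse A (pinv A)"
  unfolding pinv_def
  by (rule theI') (metis is_pseudoinverse_exists is_pseudoinverse_unique)

definition spectral_norm :: "real ^ 'd ^ 'n \<Rightarrow> real" where
  "spectral_norm A = onorm (\<lambda>x. A *v x)"

definition frobenius_norm :: "real ^ 'd ^ 'n \<Rightarrow> real" where
  "frobenius_norm A = sqrt (\<Sum>i\<in>UNIV. \<Sum>j\<in>UNIV. (A $ i $ j)\<^sup>2)"

definition demmel_cond :: "real ^ 'd ^ 'n \<Rightarrow> real" where
  "demmel_cond A = spectral_norm (pinv A) * frobenius_norm A"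

text \<open>The Kaczmarz iterates driven by a given sequence of row indices. For a zero row the
  quotient is \<open>0\<close>, so such a step leaves the iterate unchanged; zero rows have sampling
  probability \<open>0\<close> below.\<close>

primrec kaczmarz ::
  "real ^ 'd ^ 'n \<Rightarrow> real ^ 'n \<Rightarrow> real ^ 'd \<Rightarrow> (nat \<Rightarrow> 'n) \<Rightarrow> nat \<Rightarrow> real ^ 'd" where
  "kaczmarz A b x0 i 0 = x0"
| "kaczmarz A b x0 i (Suc t) =
     (let x = kaczmarz A b x0 i t
      in x + ((b $ i t - A $ i t \<bullet> x) / (norm (A $ i t))\<^sup>2) *\<^sub>R (A $ i t))"

definition tail_average :: "nat \<Rightarrow> nat \<Rightarrow> (nat \<Rightarrow> real ^ 'd) \<Rightarrow> real ^ 'd" where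
  "tail_average tb t x = (1 / real (t - tb)) *\<^sub>R (\<Sum>s\<in>{tb..<t}. x s)"

text \<open>\<open>I t \<omega>\<close> is the row index drawn in step \<open>t\<close>.\<close>

definition rk_sampling ::
  "'w measure \<Rightarrow> real ^ 'd ^ 'n \<Rightarrow> (nat \<Rightarrow> 'w \<Rightarrow> 'n) \<Rightarrow> bool" where
  "rk_sampling M A I \<longleftrightarrow>
     prob_space M \<and>
     prob_space.indep_vars M (\<lambda>_. count_space UNIV) I UNIV \<and>
     (\<forall>t k. measure M {\<omega> \<in> space M. I t \<omega> = k} =
        (norm (A $ k))\<^sup>2 / (frobenius_norm A)\<^sup>2)"

end

theory Submission
  imports Defs
begin

text \<open>
  The errors \<open>e s = x s - x_star\<close> are themselves Kaczmarz iterates, for the right-hand side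
  \<open>r = b - A x_star\<close>, which is orthogonal to the range of \<open>A\<close>; so in conditional mean one step is
  the map \<open>T = 1 - A\<^sup>T A / F\<close> with \<open>F\<close> the squared Frobenius norm. On the row space of \<open>A\<close>,
  which contains all errors, \<open>T\<close> is positive semidefinite and bounded by \<open>q = 1 - 1 / \<kappa>\<^sup>2\<close>. Hence
  \<open>E \<langle>e s, e (s + j)\<rangle> = E \<langle>e s, T\<^sup>j e s\<rangle> \<le> q\<^sup>j E \<parallel>e s\<parallel>\<^sup>2\<close>, and summing the geometric series bounds the
  second moment of the sum of the errors by \<open>2 \<kappa>\<^sup>2 - 1\<close> times the sum of their second moments. The
  latter obey the recursion \<open>E \<parallel>e (s + 1)\<parallel>\<^sup>2 \<le> q E \<parallel>e s\<parallel>\<^sup>2 + \<parallel>r\<parallel>\<^sup>2 / F\<close>.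
\<close>

section \<open>Sampling from a finite set\<close>

text \<open>A combinatorial stand-in for measurability with respect to the first \<open>m\<close>
  draws. As the indices range over a finite type, it already yields measurability and
  integrability.\<close>

definition prefix_determined :: "nat \<Rightarrow> ((nat \<Rightarrow> 'i) \<Rightarrow> 'a) \<Rightarrow> bool" where
  "prefix_determined m f \<longleftrightarrow> (\<forall>i j. (\<forall>l<m. i l = j l) \<longrightarrow> f i = f j)"

lemma prefix_determined_mono:
  "prefix_determined m f \<Longrightarrow> m \<le> n \<Longrightarrow> prefix_determined n f"
  unfolding prefix_determined_def by (meson less_le_trans)

lemma prefix_determined_compose:
  "prefix_determined m f \<Longrightarrow> prefix_determined m (\<lambda>i. g (f i))"
  unfolding prefix_determined_def by metis

lemma prefix_determined_compose2:
  "prefix_determined m f \<Longrightarrow> prefix_determined m g \<Longrightarrow> prefix_determined m (\<lambda>i. h (f i) (g i))"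
  unfolding prefix_determined_def by metis

lemma prefix_determined_restrict:
  assumes "prefix_determined m f"
  shows "f (restrict i {..<m}) = f i"
  using assms[unfolded prefix_determined_def, rule_format, of "restrict i {..<m}" i] by simp

locale iid_draws = prob_space M for M :: "'w measure" +
  fixes I :: "nat \<Rightarrow> 'w \<Rightarrow> 'i::finite" and p :: "'i \<Rightarrow> real"
  assumes indep_draws: "indep_vars (\<lambda>_. count_space UNIV) I UNIV"
    and prob_draw: "measure M {\<omega> \<in> space M. I t \<omega> = k} = p k"
begin

lemma measurable_draw: "I t \<in> measurable M (count_space UNIV)"
  using indep_draws by (auto simp: indep_vars_def)

lemma measurable_fun_draws:
  fixes f :: "(nat \<Rightarrow> 'i) \<Rightarrow> real"
  assumes "finite J"
  shows "f \<in> borel_measurable (PiM J (\<lambda>_. count_space UNIV))"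
  by (subst count_space_PiM_finite) (use assms in auto)

lemma random_variable_prefix:
  fixes f :: "(nat \<Rightarrow> 'i) \<Rightarrow> real"
  assumes "prefix_determined m f"
  shows "(\<lambda>\<omega>. f (\<lambda>s. I s \<omega>)) \<in> borel_measurable M"
proof -
  have "(\<lambda>\<omega>. restrict (\<lambda>s. I s \<omega>) {..<m}) \<in> measurable M (PiM {..<m} (\<lambda>_. count_space UNIV))"
    by (intro measurable_restrict measurable_draw)
  from measurable_compose[OF this measurable_fun_draws[of "{..<m}" f]]
  show ?thesis by (simp add: prefix_determined_restrict[OF assms])
qed

text \<open>Up to restriction to \<open>{..<m}\<close> there are only finitely many index sequences,
  so \<open>f\<close> takes finitely many values and is bounded.\<close>

lemma integrable_prefix:
  fixes f :: "(nat \<Rightarrow> 'i) \<Rightarrow> real"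
  assumes "prefix_determined m f"
  shows "integrable M (\<lambda>\<omega>. f (\<lambda>s. I s \<omega>))"
proof -
  let ?R = "PiE {..<m} (\<lambda>_. UNIV :: 'i set)"
  have "finite ((\<lambda>i. norm (f i)) ` ?R)" by (intro finite_imageI finite_PiE) auto
  from bdd_above_finite[OF this] obtain B where B: "\<And>i. i \<in> ?R \<Longrightarrow> norm (f i) \<le> B"
    by (auto simp: bdd_above_def)
  have "norm (f i) \<le> B" for i
    using B[of "restrict i {..<m}"] by (simp add: prefix_determined_restrict[OF assms])
  then show ?thesis
    by (intro integrable_const_bound[of _ B] random_variable_prefix[OF assms]) auto
qed

text \<open>Plays the role of conditioning on the first \<open>m\<close> draws. Splitting over the
  value \<open>k\<close> of draw \<open>m\<close> leaves products of a function of the prefix and an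
  indicator of draw \<open>m\<close>, and these factors are independent.\<close>

lemma expectation_next_draw:
  fixes f :: "(nat \<Rightarrow> 'i) \<Rightarrow> 'i \<Rightarrow> real"
  assumes f: "prefix_determined m f"
  shows "expectation (\<lambda>\<omega>. f (\<lambda>s. I s \<omega>) (I m \<omega>)) =
    expectation (\<lambda>\<omega>. \<Sum>k\<in>UNIV. p k * f (\<lambda>s. I s \<omega>) k)"
proof -
  have fk: "prefix_determined m (\<lambda>i. f i k)" for k
    using prefix_determined_compose[OF f, of "\<lambda>g. g k"] .
  have at_m: "prefix_determined (Suc m) (\<lambda>i. indicator {k} (i m) :: real)" for k :: 'i
    by (simp add: prefix_determined_def)
  have prod: "integrable M (\<lambda>\<omega>. f (\<lambda>s. I s \<omega>) k * indicator {k} (I m \<omega>))" for k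
    using integrable_prefix[OF prefix_determined_compose2[where h = "(*)",
        OF prefix_determined_mono[OF fk le_SucI[OF order_refl]] at_m]] by simp
  have split: "expectation (\<lambda>\<omega>. f (\<lambda>s. I s \<omega>) k * indicator {k} (I m \<omega>)) =
      p k * expectation (\<lambda>\<omega>. f (\<lambda>s. I s \<omega>) k)" for k
  proof -
    let ?g = "\<lambda>i :: nat \<Rightarrow> 'i. indicator {k} (i m) :: real"
    \<comment> \<open>The index sets \<open>{..<m}\<close> and \<open>{m}\<close> are disjoint, so
      the two blocks of draws are independent, and so are functions of each.\<close>
    have "indep_var borel ((\<lambda>i. f i k) \<circ> (\<lambda>\<omega>. restrict (\<lambda>s. I s \<omega>) {..<m}))
        borel (?g \<circ> (\<lambda>\<omega>. restrict (\<lambda>s. I s \<omega>) {m}))"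
      by (rule indep_var_compose[OF indep_var_restrict[OF indep_draws]])
         (auto intro!: measurable_fun_draws)
    then have "indep_var borel (\<lambda>\<omega>. f (\<lambda>s. I s \<omega>) k) borel (\<lambda>\<omega>. indicator {k} (I m \<omega>) :: real)"
      by (simp add: comp_def prefix_determined_restrict[OF fk])
    then have "expectation (\<lambda>\<omega>. f (\<lambda>s. I s \<omega>) k * indicator {k} (I m \<omega>)) =
        expectation (\<lambda>\<omega>. f (\<lambda>s. I s \<omega>) k) * expectation (\<lambda>\<omega>. indicator {k} (I m \<omega>))"
      by (rule indep_var_lebesgue_integral)
         (rule integrable_prefix[OF fk], rule integrable_prefix[OF at_m])
    moreover have "expectation (\<lambda>\<omega>. indicator {k} (I m \<omega>)) = p k"
    proof -
      have "expectation (\<lambda>\<omega>. indicator {k} (I m \<omega>)) =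
          expectation (indicator {\<omega> \<in> space M. I m \<omega> = k})"
        by (intro Bochner_Integration.integral_cong) (auto simp: indicator_def)
      also have "\<dots> = measure M {\<omega> \<in> space M. I m \<omega> = k}"
        by (simp add: Int_absorb2 Collect_restrict)
      finally show ?thesis by (simp add: prob_draw)
    qed
    ultimately show ?thesis by simp
  qed
  have "expectation (\<lambda>\<omega>. f (\<lambda>s. I s \<omega>) (I m \<omega>)) =
      expectation (\<lambda>\<omega>. \<Sum>k\<in>UNIV. f (\<lambda>s. I s \<omega>) k * indicator {k} (I m \<omega>))"
    by (intro Bochner_Integration.integral_cong) (auto simp: indicator_def)
  also have "\<dots> = (\<Sum>k\<in>UNIV. p k * expectation (\<lambda>\<omega>. f (\<lambda>s. I s \<omega>) k))"
    by (subst Bochner_Integration.integral_sum) (simp_all only: prod split)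
  also have "\<dots> = expectation (\<lambda>\<omega>. \<Sum>k\<in>UNIV. p k * f (\<lambda>s. I s \<omega>) k)"
    by (simp add: integrable_prefix[OF fk])
  finally show ?thesis .
qed

end


section \<open>Row space and pseudoinverse\<close>

text \<open>Written with \<open>v*\<close> because the simplifier turns
  \<open>transpose A *v y\<close> into \<open>y v* A\<close>.\<close>

definition row_space :: "real ^ 'd ^ 'n \<Rightarrow> (real ^ 'd) set" where
  "row_space A = range (\<lambda>y. y v* A)"

lemma subspace_row_space: "subspace (row_space A)"
proof -
  have "subspace (range (\<lambda>y. transpose A *v y))"
    by (intro linear_subspace_image matrix_vector_mul_linear subspace_UNIV)
  then show ?thesis by (simp add: row_space_def)
qed

lemma row_in_row_space: "A $ k \<in> row_space A"
proof -
  have "A $ k = axis k 1 v* A"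
    by (simp add: vec_eq_iff vector_matrix_mult_def axis_def if_distrib if_distribR cong: if_cong)
  then show ?thesis unfolding row_space_def by blast
qed

text \<open>With \<open>P = pinv A\<close>, symmetry of \<open>P ** A\<close> turns
  \<open>P = P ** A ** P\<close> into a product whose leftmost factor is
  \<open>transpose A\<close>.\<close>

lemma pinv_in_row_space: "pinv A *v y \<in> row_space A"
proof -
  have "pinv A = transpose (pinv A ** A) ** pinv A"
    using is_pseudoinverse_pinv[of A] by (simp add: is_pseudoinverse_def)
  also have "\<dots> = transpose A ** (transpose (pinv A) ** pinv A)"
    by (simp add: matrix_transpose_mul matrix_mul_assoc)
  finally have "pinv A *v y = transpose A *v ((transpose (pinv A) ** pinv A) *v y)"
    by (metis matrix_vector_mul_assoc)
  then show ?thesis by (simp add: row_space_def)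
qed

text \<open>\<open>pinv A ** A\<close> is symmetric, so transposing
  \<open>A ** pinv A ** A = A\<close> shows that it fixes the columns of
  \<open>transpose A\<close>.\<close>

lemma pinv_mult_row_space:
  assumes "v \<in> row_space A"
  shows "pinv A *v (A *v v) = v"
proof -
  obtain y where y: "v = transpose A *v y" using assms by (auto simp: row_space_def)
  have "pinv A ** A ** transpose A = transpose (A ** (pinv A ** A))"
    using is_pseudoinverse_pinv[of A]
    by (metis is_pseudoinverse_def matrix_transpose_mul)
  also have "\<dots> = transpose A"
    using is_pseudoinverse_pinv[of A] by (simp add: is_pseudoinverse_def matrix_mul_assoc)
  finally show ?thesis
    unfolding y by (metis matrix_vector_mul_assoc)
qed

text \<open>These are the normal equations, read off by transposing
  \<open>A ** pinv A ** A = A\<close> and using the symmetry of \<open>A ** pinv A\<close>.\<close>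

lemma residual_orthogonal: "(y - A *v (pinv A *v y)) v* A = 0"
proof -
  have "transpose A ** (A ** pinv A) = transpose ((A ** pinv A) ** A)"
    using is_pseudoinverse_pinv[of A] by (metis is_pseudoinverse_def matrix_transpose_mul)
  also have "\<dots> = transpose A"
    using is_pseudoinverse_pinv[of A] by (simp add: is_pseudoinverse_def)
  finally have "transpose A *v (A *v (pinv A *v y)) = transpose A *v y"
    by (metis matrix_vector_mul_assoc)
  then have "transpose A *v (y - A *v (pinv A *v y)) = 0"
    unfolding matrix_vector_mult_diff_distrib by simp
  then show ?thesis by simp
qed

section \<open>Norm bounds for \<open>A\<close> and the Demmel condition number\<close>

lemma norm_matrix_vector_sq: "(norm (A *v v))\<^sup>2 = (\<Sum>k\<in>UNIV. (A $ k \<bullet> v)\<^sup>2)"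
  for A :: "real ^ 'd ^ 'n"
  unfolding power2_norm_eq_inner inner_vec_def[of "A *v v"]
  by (simp add: matrix_vector_mul_component power2_eq_square)

lemma frobenius_norm_sq: "(frobenius_norm A)\<^sup>2 = (\<Sum>k\<in>UNIV. (norm (A $ k))\<^sup>2)"
proof -
  have "(\<Sum>k\<in>UNIV. (norm (A $ k))\<^sup>2) = (\<Sum>i\<in>UNIV. \<Sum>j\<in>UNIV. (A $ i $ j)\<^sup>2)"
    unfolding power2_norm_eq_inner by (simp add: inner_vec_def power2_eq_square)
  then show ?thesis
    unfolding frobenius_norm_def by (simp add: sum_nonneg)
qed

lemma norm_matrix_vector_le_frobenius:
  "(norm (A *v v))\<^sup>2 \<le> (frobenius_norm A)\<^sup>2 * (norm v)\<^sup>2"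
  unfolding norm_matrix_vector_sq frobenius_norm_sq sum_distrib_right
proof (rule sum_mono)
  fix k
  have "\<bar>A $ k \<bullet> v\<bar> \<le> norm (A $ k) * norm v" by (rule Cauchy_Schwarz_ineq2)
  then have "\<bar>A $ k \<bullet> v\<bar>\<^sup>2 \<le> (norm (A $ k) * norm v)\<^sup>2" by (rule power_mono) simp
  then show "(A $ k \<bullet> v)\<^sup>2 \<le> (norm (A $ k))\<^sup>2 * (norm v)\<^sup>2"
    by (simp add: power_mult_distrib)
qed

text \<open>Since \<open>pinv A\<close> inverts \<open>A\<close> on the row space, its norm limits
  how much \<open>A\<close> can shrink a vector there.\<close>

lemma norm_row_space_le:
  assumes "v \<in> row_space A"
  shows "(norm v)\<^sup>2 \<le> (spectral_norm (pinv A))\<^sup>2 * (norm (A *v v))\<^sup>2"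
proof -
  have "norm (pinv A *v (A *v v)) \<le> spectral_norm (pinv A) * norm (A *v v)"
    unfolding spectral_norm_def by (intro onorm) (simp add: matrix_vector_mul_bounded_linear)
  then have "(norm v)\<^sup>2 \<le> (spectral_norm (pinv A) * norm (A *v v))\<^sup>2"
    unfolding pinv_mult_row_space[OF assms] by (intro power_mono) auto
  then show ?thesis by (simp add: power_mult_distrib)
qed

lemma frobenius_norm_pos:
  assumes "A \<noteq> 0"
  shows "(frobenius_norm A)\<^sup>2 > 0"
proof -
  obtain k where "A $ k \<noteq> 0" using assms by (auto simp: vec_eq_iff)
  then have "0 < (\<Sum>k\<in>UNIV. (norm (A $ k))\<^sup>2)" by (intro sum_pos2[of _ k]) auto
  then show ?thesis by (simp add: frobenius_norm_sq)
qed

text \<open>A nonzero row lies in the row space, so the lower and the upper bound for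
  \<open>norm (A *v v)\<close> can be compared at that vector.\<close>

lemma demmel_cond_ge_1:
  assumes "A \<noteq> 0"
  shows "(demmel_cond A)\<^sup>2 \<ge> 1"
proof -
  obtain k where k: "A $ k \<noteq> 0" using assms by (auto simp: vec_eq_iff)
  let ?v = "A $ k"
  have "(norm ?v)\<^sup>2 \<le> (spectral_norm (pinv A))\<^sup>2 * (norm (A *v ?v))\<^sup>2"
    by (rule norm_row_space_le[OF row_in_row_space])
  also have "\<dots> \<le> (spectral_norm (pinv A))\<^sup>2 * ((frobenius_norm A)\<^sup>2 * (norm ?v)\<^sup>2)"
    by (intro mult_left_mono norm_matrix_vector_le_frobenius) auto
  finally have "(norm ?v)\<^sup>2 * 1 \<le> (norm ?v)\<^sup>2 * (demmel_cond A)\<^sup>2"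
    by (simp add: demmel_cond_def power_mult_distrib ac_simps)
  then show ?thesis using k by (simp only: mult_le_cancel_left) auto
qed


section \<open>The mean iteration\<close>

definition mean_step :: "real ^ 'd ^ 'n \<Rightarrow> real ^ 'd \<Rightarrow> real ^ 'd" where
  "mean_step A v = v - (1 / (frobenius_norm A)\<^sup>2) *\<^sub>R ((A *v v) v* A)"

lemma inner_mean_step:
  "mean_step A v \<bullet> w = v \<bullet> w - ((A *v v) \<bullet> (A *v w)) / (frobenius_norm A)\<^sup>2"
  unfolding mean_step_def by (simp add: inner_diff_left dot_lmul_matrix)

lemma mean_step_selfadjoint: "mean_step A v \<bullet> w = v \<bullet> mean_step A w"
  using inner_mean_step[of A v w] inner_mean_step[of A w v] by (simp add: inner_commute)

lemma mean_step_row_space: "v \<in> row_space A \<Longrightarrow> mean_step A v \<in> row_space A"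
  unfolding mean_step_def
  by (intro subspace_diff subspace_scale subspace_row_space) (auto simp: row_space_def)

lemma inner_mean_step_nonneg:
  assumes "A \<noteq> 0"
  shows "0 \<le> mean_step A v \<bullet> v"
  using norm_matrix_vector_le_frobenius[of A v] frobenius_norm_pos[OF assms]
  by (simp add: inner_mean_step power2_norm_eq_inner field_simps)

text \<open>The left-hand side arises twice: as the quadratic form of \<open>mean_step A\<close>,
  and as the noise-free part of the mean squared error after one step.\<close>

lemma energy_decay:
  assumes "A \<noteq> 0" and v: "v \<in> row_space A"
  shows "(norm v)\<^sup>2 - (norm (A *v v))\<^sup>2 / (frobenius_norm A)\<^sup>2
    \<le> (1 - 1 / (demmel_cond A)\<^sup>2) * (norm v)\<^sup>2"
proof -
  have k: "(demmel_cond A)\<^sup>2 > 0" using demmel_cond_ge_1[OF assms(1)] by linarith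
  have "(norm v)\<^sup>2 * (frobenius_norm A)\<^sup>2 \<le> (demmel_cond A)\<^sup>2 * (norm (A *v v))\<^sup>2"
    using mult_right_mono[OF norm_row_space_le[OF v], of "(frobenius_norm A)\<^sup>2"]
    by (simp add: demmel_cond_def power_mult_distrib ac_simps)
  then have "(norm v)\<^sup>2 / (demmel_cond A)\<^sup>2 \<le> (norm (A *v v))\<^sup>2 / (frobenius_norm A)\<^sup>2"
    using k frobenius_norm_pos[OF assms(1)] by (simp add: field_simps)
  then show ?thesis by (simp add: algebra_simps)
qed

lemma inner_mean_step_le:
  assumes "A \<noteq> 0" and "v \<in> row_space A"
  shows "mean_step A v \<bullet> v \<le> (1 - 1 / (demmel_cond A)\<^sup>2) * (norm v)\<^sup>2"
  using energy_decay[OF assms] by (simp add: inner_mean_step power2_norm_eq_inner)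

lemma contraction_factor:
  assumes "A \<noteq> 0"
  shows "0 \<le> 1 - 1 / (demmel_cond A)\<^sup>2" "1 - 1 / (demmel_cond A)\<^sup>2 < 1"
  using demmel_cond_ge_1[OF assms] by (auto simp: divide_simps)

lemma mean_step_combination: "mean_step A (c *\<^sub>R v - w) = c *\<^sub>R mean_step A v - mean_step A w"
proof -
  have "(y - z) v* A = y v* A - z v* A" "(a *\<^sub>R y) v* A = a *\<^sub>R (y v* A)" for a y z
    using matrix_vector_mult_diff_distrib[of "transpose A" y z]
      matrix_vector_mult_scaleR[of "transpose A" a y] by simp_all
  then show ?thesis
    unfolding mean_step_def
    by (simp add: matrix_vector_mult_diff_distrib matrix_vector_mult_scaleR algebra_simps)
qed

text \<open>A positive semidefinite self-adjoint operator whose form is at most \<open>q\<close>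
  also has norm at most \<open>q\<close>. This is derived from a quadratic inequality in a free
  parameter, without diagonalization.\<close>

lemma norm_mean_step_le:
  assumes A: "A \<noteq> 0" and v: "v \<in> row_space A"
  shows "(norm (mean_step A v))\<^sup>2 \<le> (1 - 1 / (demmel_cond A)\<^sup>2)\<^sup>2 * (norm v)\<^sup>2"
proof -
  define q where "q = 1 - 1 / (demmel_cond A)\<^sup>2"
  define w where "w = mean_step A v"
  have q0: "0 \<le> q" using contraction_factor[OF A] by (simp add: q_def)
  have vv: "w \<bullet> v \<le> q * (norm v)\<^sup>2" and ww: "mean_step A w \<bullet> w \<le> q * (norm w)\<^sup>2"
    using inner_mean_step_le[OF A v] inner_mean_step_le[OF A mean_step_row_space[OF v]]
    by (auto simp: q_def w_def)
  have wv: "mean_step A w \<bullet> v = (norm w)\<^sup>2"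
    by (simp add: mean_step_selfadjoint[of A w v] w_def[symmetric] power2_norm_eq_inner)
  \<comment> \<open>Positivity of the form at \<open>c v - w\<close> replaces the Cauchy--Schwarz inequality for the
    positive semidefinite form \<open>mean_step A v \<bullet> v\<close>.\<close>
  have quad: "2 * c * (norm w)\<^sup>2 \<le> c\<^sup>2 * (q * (norm v)\<^sup>2) + q * (norm w)\<^sup>2" for c
  proof -
    have comb: "mean_step A (c *\<^sub>R v - w) = c *\<^sub>R w - mean_step A w"
      unfolding w_def by (rule mean_step_combination)
    have "mean_step A (c *\<^sub>R v - w) \<bullet> (c *\<^sub>R v - w) =
        c\<^sup>2 * (w \<bullet> v) - 2 * c * (norm w)\<^sup>2 + mean_step A w \<bullet> w"
      unfolding comb using wv power2_norm_eq_inner[of w]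
      by (simp add: inner_diff_left inner_diff_right power2_eq_square algebra_simps)
    then have "2 * c * (norm w)\<^sup>2 \<le> c\<^sup>2 * (w \<bullet> v) + mean_step A w \<bullet> w"
      using inner_mean_step_nonneg[OF A, of "c *\<^sub>R v - w"] by linarith
    also have "\<dots> \<le> c\<^sup>2 * (q * (norm v)\<^sup>2) + q * (norm w)\<^sup>2"
      using vv ww by (intro add_mono mult_left_mono) auto
    finally show ?thesis .
  qed
  have "(norm w)\<^sup>2 \<le> q\<^sup>2 * (norm v)\<^sup>2"
  \<comment> \<open>The parameter \<open>c = q\<close> gives the bound multiplied by
    \<open>q\<close>. For \<open>q = 0\<close> that is void, and \<open>c = 1\<close> forces
    \<open>w\<close> to vanish.\<close>
  proof (cases "q = 0")
    case True
    then show ?thesis using quad[of 1] by simp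
  next
    case False
    have "q * (norm w)\<^sup>2 \<le> q * (q\<^sup>2 * (norm v)\<^sup>2)"
      using quad[of q] by (simp add: ac_simps)
    then show ?thesis using False q0 by (simp add: mult_le_cancel_left)
  qed
  then show ?thesis by (simp add: q_def w_def)
qed

text \<open>Self-adjointness moves one factor to the left, turning the exponent \<open>j + 2\<close>
  at \<open>v\<close> into the exponent \<open>j\<close> at \<open>mean_step A v\<close>, at a cost
  of \<open>q\<close> squared. Hence the induction in steps of two.\<close>

lemma inner_funpow_mean_step_le:
  assumes A: "A \<noteq> 0" and "v \<in> row_space A"
  shows "v \<bullet> (mean_step A ^^ j) v \<le> (1 - 1 / (demmel_cond A)\<^sup>2) ^ j * (norm v)\<^sup>2"
  using assms(2)
proof (induction j arbitrary: v rule: induct_nat_012)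
  case 0
  then show ?case by (simp add: power2_norm_eq_inner)
next
  case 1
  then show ?case using inner_mean_step_le[OF A] by (simp add: inner_commute)
next
  case (ge2 j)
  let ?q = "1 - 1 / (demmel_cond A)\<^sup>2" and ?w = "mean_step A v"
  have "v \<bullet> (mean_step A ^^ Suc (Suc j)) v = ?w \<bullet> (mean_step A ^^ j) ?w"
    by (simp add: mean_step_selfadjoint flip: funpow_swap1)
  also have "\<dots> \<le> ?q ^ j * (norm ?w)\<^sup>2" by (intro ge2 mean_step_row_space)
  also have "\<dots> \<le> ?q ^ j * (?q\<^sup>2 * (norm v)\<^sup>2)"
    using norm_mean_step_le[OF A ge2.prems] contraction_factor[OF A]
    by (intro mult_left_mono) auto
  finally show ?case by (simp add: power2_eq_square ac_simps)
qed


section \<open>One Kaczmarz step\<close>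

definition kaczmarz_step :: "real ^ 'd ^ 'n \<Rightarrow> real ^ 'n \<Rightarrow> 'n \<Rightarrow> real ^ 'd \<Rightarrow> real ^ 'd" where
  "kaczmarz_step A r k x = x + ((r $ k - A $ k \<bullet> x) / (norm (A $ k))\<^sup>2) *\<^sub>R (A $ k)"

lemma kaczmarz_Suc: "kaczmarz A r x0 i (Suc s) = kaczmarz_step A r (i s) (kaczmarz A r x0 i s)"
  by (simp add: kaczmarz_step_def Let_def)

text \<open>A step sees the data only through the residual entry of the chosen row, which is
  unchanged when iterate and right-hand side are shifted together.\<close>

lemma kaczmarz_shift:
  "kaczmarz A b x0 i s - x = kaczmarz A (b - A *v x) (x0 - x) i s"
proof (induction s)
  case (Suc s)
  then show ?case
    by (simp add: Let_def matrix_vector_mul_component inner_diff_right flip: Suc)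
qed simp

lemma kaczmarz_row_space: "x0 \<in> row_space A \<Longrightarrow> kaczmarz A r x0 i s \<in> row_space A"
  by (induction s)
     (auto simp: Let_def intro!: subspace_add subspace_scale subspace_row_space row_in_row_space)

text \<open>Iterate \<open>s\<close> reads the draws \<open>0\<close> to \<open>s - 1\<close> only,
  so draw \<open>s\<close> is fresh for the next step.\<close>

lemma prefix_determined_kaczmarz:
  "prefix_determined s (\<lambda>i. kaczmarz A r x0 i s)"
proof (induction s)
  case (Suc s)
  show ?case unfolding prefix_determined_def
  proof (intro allI impI)
    fix i j :: "nat \<Rightarrow> 'a" assume ij: "\<forall>l<Suc s. i l = j l"
    then have "kaczmarz A r x0 i s = kaczmarz A r x0 j s"
      using Suc unfolding prefix_determined_def by (metis less_SucI)
    then show "kaczmarz A r x0 i (Suc s) = kaczmarz A r x0 j (Suc s)"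
      using ij by (simp only: kaczmarz_Suc lessI)
  qed
qed (simp add: prefix_determined_def)

lemma sum_row_weights:
  assumes "A \<noteq> 0"
  shows "(\<Sum>k\<in>UNIV. (norm (A $ k))\<^sup>2 / (frobenius_norm A)\<^sup>2) = 1"
  using frobenius_norm_pos[OF assms]
  by (simp add: frobenius_norm_sq flip: sum_divide_distrib)

text \<open>The sampling weight cancels the denominator of the step. The noise then sums to a
  multiple of \<open>r \<bullet> (A *v u)\<close>, which is zero by orthogonality.\<close>

lemma mean_inner_kaczmarz_step:
  assumes A: "A \<noteq> 0" and r: "r v* A = 0"
  shows "(\<Sum>k\<in>UNIV. (norm (A $ k))\<^sup>2 / (frobenius_norm A)\<^sup>2 * (u \<bullet> kaczmarz_step A r k x)) =
    u \<bullet> mean_step A x"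
proof -
  let ?F = "(frobenius_norm A)\<^sup>2"
  have "(norm (A $ k))\<^sup>2 / ?F * (u \<bullet> kaczmarz_step A r k x) =
      (norm (A $ k))\<^sup>2 / ?F * (u \<bullet> x) + r $ k * (A *v u) $ k / ?F - (A *v x) $ k * (A *v u) $ k / ?F"
    for k
  proof (cases "A $ k = 0")
    case True
    then show ?thesis by (simp add: matrix_vector_mul_component)
  next
    case False
    have cancel: "N / F * (w + (c - d) / N * g) = N / F * w + c * g / F - d * g / F"
      if "N \<noteq> 0" for N F w c d g :: real
      using that by (cases "F = 0") (simp_all add: field_simps)
    have inner_step: "u \<bullet> kaczmarz_step A r k x = u \<bullet> x + (r $ k - A $ k \<bullet> x) / (norm (A $ k))\<^sup>2 * (A $ k \<bullet> u)"
      by (simp add: kaczmarz_step_def inner_add_right inner_commute[of u "A $ k"])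
    show ?thesis
      unfolding inner_step matrix_vector_mul_component by (rule cancel) (use False in simp)
  qed
  moreover have "(\<Sum>k\<in>UNIV. y $ k * z $ k / ?F) = (y \<bullet> z) / ?F" for y z :: "real ^ 'b"
    by (simp add: inner_vec_def sum_divide_distrib)
  ultimately have "(\<Sum>k\<in>UNIV. (norm (A $ k))\<^sup>2 / ?F * (u \<bullet> kaczmarz_step A r k x)) =
      (\<Sum>k\<in>UNIV. (norm (A $ k))\<^sup>2 / ?F) * (u \<bullet> x) + (r \<bullet> (A *v u)) / ?F
        - ((A *v x) \<bullet> (A *v u)) / ?F"
    by (simp only: sum_subtractf sum.distrib sum_distrib_right)
  also have "r \<bullet> (A *v u) = 0" using r by (simp flip: dot_lmul_matrix)
  finally show ?thesis
    using inner_mean_step[of A x u] sum_row_weights[OF A] by (simp add: inner_commute)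
qed

text \<open>For a nonzero row the step projects onto the hyperplane of that equation, and expanding
  the square makes the cross terms in \<open>r $ k\<close> cancel.\<close>

lemma mean_norm_kaczmarz_step:
  assumes A: "A \<noteq> 0"
  shows "(\<Sum>k\<in>UNIV. (norm (A $ k))\<^sup>2 / (frobenius_norm A)\<^sup>2 * (norm (kaczmarz_step A r k x))\<^sup>2)
    \<le> (norm x)\<^sup>2 - (norm (A *v x))\<^sup>2 / (frobenius_norm A)\<^sup>2 + (norm r)\<^sup>2 / (frobenius_norm A)\<^sup>2"
proof -
  let ?F = "(frobenius_norm A)\<^sup>2"
  have le: "(norm (A $ k))\<^sup>2 / ?F * (norm (kaczmarz_step A r k x))\<^sup>2 \<le>
      (norm (A $ k))\<^sup>2 / ?F * (norm x)\<^sup>2 - (A $ k \<bullet> x)\<^sup>2 / ?F + (r $ k)\<^sup>2 / ?F" for k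
  proof (cases "A $ k = 0")
    \<comment> \<open>Zero rows are why this is only an inequality: the left side is
      \<open>0\<close>, while the term in \<open>r $ k\<close> may be positive.\<close>
    case True
    then show ?thesis by simp
  next
    case False
    then have pos: "(norm (A $ k))\<^sup>2 > 0" by simp
    let ?a = "A $ k" and ?c = "r $ k - A $ k \<bullet> x"
    have expand: "(norm (x + c *\<^sub>R ?a))\<^sup>2 = (norm x)\<^sup>2 + 2 * c * (?a \<bullet> x) + c\<^sup>2 * (norm ?a)\<^sup>2" for c
      unfolding power2_norm_eq_inner
      by (simp add: inner_add_left inner_add_right inner_commute[of x ?a] power2_eq_square
          distrib_left)
    have "(norm (kaczmarz_step A r k x))\<^sup>2 =
        (norm x)\<^sup>2 + 2 * (?c / (norm ?a)\<^sup>2) * (?a \<bullet> x) + (?c / (norm ?a)\<^sup>2)\<^sup>2 * (norm ?a)\<^sup>2"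
      unfolding kaczmarz_step_def by (rule expand)
    moreover have "N * (z + 2 * (c / N) * g + (c / N)\<^sup>2 * N) = N * z + 2 * c * g + c\<^sup>2"
      if "N > 0" for N z c g :: real
      using that by (simp add: field_simps power2_eq_square)
    ultimately have "(norm ?a)\<^sup>2 * (norm (kaczmarz_step A r k x))\<^sup>2 =
        (norm ?a)\<^sup>2 * (norm x)\<^sup>2 + 2 * ?c * (?a \<bullet> x) + ?c\<^sup>2"
      using pos by (simp only:)
    also have "\<dots> = (norm ?a)\<^sup>2 * (norm x)\<^sup>2 - (?a \<bullet> x)\<^sup>2 + (r $ k)\<^sup>2"
      by (simp add: algebra_simps power2_eq_square)
    finally show ?thesis
      by (simp add: add_divide_distrib diff_divide_distrib)
  qed
  have "(\<Sum>k\<in>UNIV. (norm (A $ k))\<^sup>2 / ?F * (norm (kaczmarz_step A r k x))\<^sup>2) \<le>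
      (\<Sum>k\<in>UNIV. (norm (A $ k))\<^sup>2 / ?F * (norm x)\<^sup>2 - (A $ k \<bullet> x)\<^sup>2 / ?F + (r $ k)\<^sup>2 / ?F)"
    by (intro sum_mono le)
  also have "\<dots> = (\<Sum>k\<in>UNIV. (norm (A $ k))\<^sup>2 / ?F) * (norm x)\<^sup>2
      - (norm (A *v x))\<^sup>2 / ?F + (norm r)\<^sup>2 / ?F"
    unfolding norm_matrix_vector_sq power2_norm_eq_inner[of r] inner_vec_def[of r]
    by (simp add: sum_subtractf sum.distrib flip: sum_distrib_right sum_divide_distrib power2_eq_square)
  finally show ?thesis by (simp add: sum_row_weights[OF A])
qed


section \<open>Second moments along the iteration\<close>

locale kaczmarz_residual =
  iid_draws M I "\<lambda>k. (norm (A $ k))\<^sup>2 / (frobenius_norm A)\<^sup>2"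
  for M :: "'w measure" and I :: "nat \<Rightarrow> 'w \<Rightarrow> 'n::finite" and A :: "real ^ 'd::finite ^ 'n" +
  fixes r :: "real ^ 'n" and e0 :: "real ^ 'd"
  assumes A_nonzero: "A \<noteq> 0" and r_orth: "r v* A = 0" and e0: "e0 \<in> row_space A"
begin

abbreviation err :: "nat \<Rightarrow> 'w \<Rightarrow> real ^ 'd" where
  "err s \<omega> \<equiv> kaczmarz A r e0 (\<lambda>s. I s \<omega>) s"

abbreviation q :: real where
  "q \<equiv> 1 - 1 / (demmel_cond A)\<^sup>2"

text \<open>A general \<open>h\<close> of two iterates covers cross terms as well as functions of a
  single iterate.\<close>

lemma integrable_err: "integrable M (\<lambda>\<omega>. h (err s \<omega>) (err u \<omega>) :: real)"
  by (rule integrable_prefix[of "max s u"], rule prefix_determined_compose2[where h = h];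
      rule prefix_determined_mono[OF prefix_determined_kaczmarz], simp)

text \<open>Averaging over the last draw produces one \<open>mean_step A\<close>, which
  self-adjointness moves onto the earlier factor. The function \<open>g\<close> is arbitrary so that
  the induction can absorb it.\<close>

lemma expectation_inner_err:
  "expectation (\<lambda>\<omega>. g (err s \<omega>) \<bullet> err (s + j) \<omega>) =
   expectation (\<lambda>\<omega>. g (err s \<omega>) \<bullet> (mean_step A ^^ j) (err s \<omega>))"
proof (induction j arbitrary: g)
  case (Suc j)
  have "expectation (\<lambda>\<omega>. g (err s \<omega>) \<bullet> err (s + Suc j) \<omega>) =
      expectation (\<lambda>\<omega>. g (err s \<omega>) \<bullet> kaczmarz_step A r (I (s + j) \<omega>) (err (s + j) \<omega>))"
    by (simp only: add_Suc_right kaczmarz_Suc)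
  also have "\<dots> = expectation (\<lambda>\<omega>. \<Sum>k\<in>UNIV. (norm (A $ k))\<^sup>2 / (frobenius_norm A)\<^sup>2 *
      (g (err s \<omega>) \<bullet> kaczmarz_step A r k (err (s + j) \<omega>)))"
    by (rule expectation_next_draw[where f = "\<lambda>i k. g (kaczmarz A r e0 i s) \<bullet>
          kaczmarz_step A r k (kaczmarz A r e0 i (s + j))"])
       (rule prefix_determined_compose2[where h = "\<lambda>x y k. g x \<bullet> kaczmarz_step A r k y"];
        rule prefix_determined_mono[OF prefix_determined_kaczmarz], simp)
  also have "\<dots> = expectation (\<lambda>\<omega>. mean_step A (g (err s \<omega>)) \<bullet> err (s + j) \<omega>)"
    by (simp only: mean_inner_kaczmarz_step[OF A_nonzero r_orth] mean_step_selfadjoint)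
  also have "\<dots> = expectation (\<lambda>\<omega>. g (err s \<omega>) \<bullet> (mean_step A ^^ Suc j) (err s \<omega>))"
    using Suc[of "\<lambda>x. mean_step A (g x)"] by (simp add: mean_step_selfadjoint)
  finally show ?case .
qed simp

lemma expectation_cross_le:
  "expectation (\<lambda>\<omega>. err s \<omega> \<bullet> err (s + j) \<omega>) \<le> q ^ j * expectation (\<lambda>\<omega>. (norm (err s \<omega>))\<^sup>2)"
proof -
  have "expectation (\<lambda>\<omega>. err s \<omega> \<bullet> err (s + j) \<omega>) =
      expectation (\<lambda>\<omega>. err s \<omega> \<bullet> (mean_step A ^^ j) (err s \<omega>))"
    by (rule expectation_inner_err)
  also have "\<dots> \<le> expectation (\<lambda>\<omega>. q ^ j * (norm (err s \<omega>))\<^sup>2)"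
    by (intro integral_mono integrable_err[of "\<lambda>x y. x \<bullet> (mean_step A ^^ j) x"]
        integrable_err[of "\<lambda>x y. q ^ j * (norm x)\<^sup>2"]
        inner_funpow_mean_step_le[OF A_nonzero] kaczmarz_row_space[OF e0])
  finally show ?thesis by simp
qed

lemma expectation_norm_err_Suc:
  "expectation (\<lambda>\<omega>. (norm (err (Suc s) \<omega>))\<^sup>2) \<le>
   q * expectation (\<lambda>\<omega>. (norm (err s \<omega>))\<^sup>2) + (norm r)\<^sup>2 / (frobenius_norm A)\<^sup>2"
proof -
  let ?w = "\<lambda>k. (norm (A $ k))\<^sup>2 / (frobenius_norm A)\<^sup>2"
  have "expectation (\<lambda>\<omega>. (norm (err (Suc s) \<omega>))\<^sup>2) =
      expectation (\<lambda>\<omega>. (norm (kaczmarz_step A r (I s \<omega>) (err s \<omega>)))\<^sup>2)"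
    by (simp only: kaczmarz_Suc)
  also have "\<dots> = expectation (\<lambda>\<omega>. \<Sum>k\<in>UNIV. ?w k * (norm (kaczmarz_step A r k (err s \<omega>)))\<^sup>2)"
    by (rule expectation_next_draw[where f = "\<lambda>i k.
            (norm (kaczmarz_step A r k (kaczmarz A r e0 i s)))\<^sup>2"])
       (rule prefix_determined_compose[OF prefix_determined_kaczmarz,
          where g = "\<lambda>x k. (norm (kaczmarz_step A r k x))\<^sup>2"])
  also have "\<dots> \<le> expectation (\<lambda>\<omega>. q * (norm (err s \<omega>))\<^sup>2 + (norm r)\<^sup>2 / (frobenius_norm A)\<^sup>2)"
  proof (intro integral_mono)
    show "integrable M (\<lambda>\<omega>. \<Sum>k\<in>UNIV. ?w k * (norm (kaczmarz_step A r k (err s \<omega>)))\<^sup>2)"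
      by (rule integrable_err[of "\<lambda>x y. \<Sum>k\<in>UNIV. ?w k * (norm (kaczmarz_step A r k x))\<^sup>2"])
    show "integrable M (\<lambda>\<omega>. q * (norm (err s \<omega>))\<^sup>2 + (norm r)\<^sup>2 / (frobenius_norm A)\<^sup>2)"
      by (rule integrable_err[of "\<lambda>x y. q * (norm x)\<^sup>2 + (norm r)\<^sup>2 / (frobenius_norm A)\<^sup>2"])
    show "(\<Sum>k\<in>UNIV. ?w k * (norm (kaczmarz_step A r k (err s \<omega>)))\<^sup>2) \<le>
        q * (norm (err s \<omega>))\<^sup>2 + (norm r)\<^sup>2 / (frobenius_norm A)\<^sup>2" for \<omega>
      using mean_norm_kaczmarz_step[OF A_nonzero, of r "err s \<omega>"]
        energy_decay[OF A_nonzero kaczmarz_row_space[OF e0], of r "\<lambda>s. I s \<omega>" s]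
      by linarith
  qed
  also have "\<dots> = q * expectation (\<lambda>\<omega>. (norm (err s \<omega>))\<^sup>2) + (norm r)\<^sup>2 / (frobenius_norm A)\<^sup>2"
    using integrable_err[of "\<lambda>x y. (norm x)\<^sup>2" s s] by (simp add: prob_space)
  finally show ?thesis .
qed

lemma expectation_norm_err_le:
  "expectation (\<lambda>\<omega>. (norm (err s \<omega>))\<^sup>2) \<le>
   q ^ s * (norm e0)\<^sup>2 + (spectral_norm (pinv A))\<^sup>2 * (norm r)\<^sup>2"
proof (induction s)
  case 0
  then show ?case by (simp add: prob_space)
next
  case (Suc s)
  define V where "V = (spectral_norm (pinv A))\<^sup>2 * (norm r)\<^sup>2"
  \<comment> \<open>\<open>V\<close> is the fixed point of the scalar recursion in \<open>expectation_norm_err_Suc\<close>.\<close>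
  have fixpoint: "q * V + (norm r)\<^sup>2 / (frobenius_norm A)\<^sup>2 = V"
  proof -
    \<comment> \<open>This factor is cancelled next; if it vanished, so would
      \<open>demmel_cond A\<close>.\<close>
    have "(spectral_norm (pinv A))\<^sup>2 \<noteq> 0"
      using demmel_cond_ge_1[OF A_nonzero] by (auto simp: demmel_cond_def)
    then have "V / (demmel_cond A)\<^sup>2 = (norm r)\<^sup>2 / (frobenius_norm A)\<^sup>2"
      by (simp add: V_def demmel_cond_def power_mult_distrib)
    then show ?thesis by (simp add: algebra_simps)
  qed
  have "q * expectation (\<lambda>\<omega>. (norm (err s \<omega>))\<^sup>2) \<le> q * (q ^ s * (norm e0)\<^sup>2 + V)"
    using Suc contraction_factor[OF A_nonzero] by (intro mult_left_mono) (auto simp: V_def)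
  also have "\<dots> = q ^ Suc s * (norm e0)\<^sup>2 + q * V"
    by (simp add: distrib_left)
  finally show ?case
    using expectation_norm_err_Suc[of s] fixpoint unfolding V_def[symmetric] by linarith
qed

end


section \<open>Tail averages\<close>

text \<open>Each mixed pair is filed under its smaller index, so that the later iterate can be
  averaged given the earlier one.\<close>

lemma norm_sum_sq:
  fixes f :: "nat \<Rightarrow> 'a::real_inner"
  shows "(norm (\<Sum>s\<in>{a..<c}. f s))\<^sup>2 =
    (\<Sum>s\<in>{a..<c}. (norm (f s))\<^sup>2 + 2 * (\<Sum>u\<in>{Suc s..<c}. f s \<bullet> f u))"
proof (induction c)
  case (Suc c)
  show ?case
  proof (cases "a \<le> c")
    case True
    have "(\<Sum>s\<in>{a..<c}. (norm (f s))\<^sup>2 + 2 * (\<Sum>u\<in>{Suc s..<Suc c}. f s \<bullet> f u)) =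
        (\<Sum>s\<in>{a..<c}. (norm (f s))\<^sup>2 + 2 * (\<Sum>u\<in>{Suc s..<c}. f s \<bullet> f u) + 2 * (f s \<bullet> f c))"
      by (intro sum.cong) auto
    also have "\<dots> = (norm (\<Sum>s\<in>{a..<c}. f s))\<^sup>2 + 2 * ((\<Sum>s\<in>{a..<c}. f s) \<bullet> f c)"
      by (simp add: Suc sum.distrib inner_sum_left sum_distrib_left)
    finally show ?thesis using True
      by (simp add: power2_norm_eq_inner inner_add_left inner_add_right inner_commute)
  qed simp
qed simp

lemma sum_geometric_le:
  fixes q :: real
  assumes "0 \<le> q" "q < 1"
  shows "(\<Sum>j<n. q ^ j) \<le> 1 / (1 - q)"
proof -
  have "(\<Sum>j<n. q ^ j) = (1 - q ^ n) / (1 - q)"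
    using assms by (simp add: sum_gp_strict)
  also have "\<dots> \<le> 1 / (1 - q)" using assms by (intro divide_right_mono) auto
  finally show ?thesis .
qed

text \<open>The averaging weights sum to one because the window is nonempty.\<close>

lemma tail_average_diff:
  assumes "tb < t"
  shows "tail_average tb t x - v = tail_average tb t (\<lambda>s. x s - v)"
  using assms
  by (simp add: tail_average_def sum_subtractf sum_constant_scaleR scaleR_diff_right del: sum_constant)

context kaczmarz_residual
begin

text \<open>For fixed \<open>s\<close> the later iterates contribute the geometric series without
  its first term, at most \<open>\<kappa>\<^sup>2 - 1\<close>. Counted twice and added to the
  diagonal term, this gives \<open>2 * \<kappa>\<^sup>2 - 1\<close>.\<close>

lemma expectation_norm_sum_err_le:
  "expectation (\<lambda>\<omega>. (norm (\<Sum>s\<in>{a..<c}. err s \<omega>))\<^sup>2) \<le>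
   (2 * (demmel_cond A)\<^sup>2 - 1) * (\<Sum>s\<in>{a..<c}. expectation (\<lambda>\<omega>. (norm (err s \<omega>))\<^sup>2))"
proof -
  let ?D = "\<lambda>s. expectation (\<lambda>\<omega>. (norm (err s \<omega>))\<^sup>2)"
  note q = contraction_factor[OF A_nonzero]
  have inv: "1 / (1 - q) = (demmel_cond A)\<^sup>2" by simp
  have cross: "(\<Sum>u\<in>{Suc s..<c}. expectation (\<lambda>\<omega>. err s \<omega> \<bullet> err u \<omega>)) \<le>
      ((demmel_cond A)\<^sup>2 - 1) * ?D s" if "s < c" for s
  proof -
    have "(\<Sum>u\<in>{Suc s..<c}. expectation (\<lambda>\<omega>. err s \<omega> \<bullet> err u \<omega>)) \<le>
        (\<Sum>u\<in>{Suc s..<c}. q ^ (u - s) * ?D s)"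
    proof (rule sum_mono)
      fix u assume "u \<in> {Suc s..<c}"
      then show "expectation (\<lambda>\<omega>. err s \<omega> \<bullet> err u \<omega>) \<le> q ^ (u - s) * ?D s"
        using expectation_cross_le[of s "u - s"] by simp
    qed
    also have "\<dots> = (\<Sum>u\<in>{Suc s..<c}. q ^ (u - s)) * ?D s"
      by (simp only: sum_distrib_right)
    also have "\<dots> \<le> ((demmel_cond A)\<^sup>2 - 1) * ?D s"
    proof (rule mult_right_mono)
      have "(\<Sum>u\<in>{Suc s..<c}. q ^ (u - s)) = (\<Sum>j\<in>{1..<c - s}. q ^ j)"
        by (rule sum.reindex_bij_witness[of _ "\<lambda>j. j + s" "\<lambda>u. u - s"]) auto
      also have "\<dots> = (\<Sum>j<c - s. q ^ j) - 1"
        using that by (simp only: lessThan_atLeast0 sum.atLeast_Suc_lessThan[of 0 "c - s"]) simp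
      also have "\<dots> \<le> (demmel_cond A)\<^sup>2 - 1"
        using sum_geometric_le[OF q, of "c - s"] inv by simp
      finally show "(\<Sum>u\<in>{Suc s..<c}. q ^ (u - s)) \<le> (demmel_cond A)\<^sup>2 - 1" .
    qed simp
    finally show ?thesis .
  qed
  have int1: "integrable M (\<lambda>\<omega>. (norm (err s \<omega>))\<^sup>2)" for s
    by (rule integrable_err[of "\<lambda>x y. (norm x)\<^sup>2"])
  have int2: "integrable M (\<lambda>\<omega>. err s \<omega> \<bullet> err u \<omega>)" for s u
    by (rule integrable_err)
  have "expectation (\<lambda>\<omega>. (norm (\<Sum>s\<in>{a..<c}. err s \<omega>))\<^sup>2) =
      (\<Sum>s\<in>{a..<c}. ?D s + 2 * (\<Sum>u\<in>{Suc s..<c}. expectation (\<lambda>\<omega>. err s \<omega> \<bullet> err u \<omega>)))"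
    unfolding norm_sum_sq by (simp add: int1 int2)
  also have "\<dots> \<le> (\<Sum>s\<in>{a..<c}. ?D s + 2 * (((demmel_cond A)\<^sup>2 - 1) * ?D s))"
    by (intro sum_mono add_left_mono mult_left_mono cross) auto
  also have "\<dots> = (2 * (demmel_cond A)\<^sup>2 - 1) * (\<Sum>s\<in>{a..<c}. ?D s)"
    by (simp add: sum_distrib_left algebra_simps)
  finally show ?thesis .
qed

text \<open>The decaying part sums to a bound independent of the window length; only the noise floor
  is multiplied by that length.\<close>

lemma sum_expectation_norm_err_le:
  assumes "a \<le> c"
  shows "(\<Sum>s\<in>{a..<c}. expectation (\<lambda>\<omega>. (norm (err s \<omega>))\<^sup>2)) \<le>
    (demmel_cond A)\<^sup>2 * q ^ a * (norm e0)\<^sup>2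
      + real (c - a) * ((spectral_norm (pinv A))\<^sup>2 * (norm r)\<^sup>2)"
proof -
  note q = contraction_factor[OF A_nonzero]
  have inv: "1 / (1 - q) = (demmel_cond A)\<^sup>2" by simp
  have "(\<Sum>s\<in>{a..<c}. expectation (\<lambda>\<omega>. (norm (err s \<omega>))\<^sup>2)) \<le>
      (\<Sum>s\<in>{a..<c}. q ^ s * (norm e0)\<^sup>2 + (spectral_norm (pinv A))\<^sup>2 * (norm r)\<^sup>2)"
    by (intro sum_mono expectation_norm_err_le)
  also have "\<dots> = (\<Sum>s\<in>{a..<c}. q ^ s) * (norm e0)\<^sup>2
      + real (c - a) * ((spectral_norm (pinv A))\<^sup>2 * (norm r)\<^sup>2)"
    by (simp only: sum.distrib sum_distrib_right sum_constant card_atLeastLessThan)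
  also have "(\<Sum>s\<in>{a..<c}. q ^ s) = q ^ a * (\<Sum>j<c - a. q ^ j)"
    unfolding sum_distrib_left power_add[symmetric]
    by (rule sum.reindex_bij_witness[of _ "\<lambda>j. a + j" "\<lambda>s. s - a"]) (use assms in auto)
  also have "q ^ a * (\<Sum>j<c - a. q ^ j) \<le> q ^ a * (demmel_cond A)\<^sup>2"
    using sum_geometric_le[OF q, of "c - a"] inv q(1) by (intro mult_left_mono) auto
  finally show ?thesis by (simp add: mult_right_mono ac_simps)
qed

end

theorem theorem3:
  fixes A :: "real ^ 'd ^ 'n" and b :: "real ^ 'n" and x0 x_star :: "real ^ 'd"
    and t t\<^sub>b :: nat and M :: "'w measure" and I :: "nat \<Rightarrow> 'w \<Rightarrow> 'n" and \<kappa> :: real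
  assumes "A \<noteq> 0"
    and "CARD('n) > CARD('d)"
    and "x_star = pinv A *v b"
    and "\<kappa> = demmel_cond A"
    and "x0 \<in> range (\<lambda>y. transpose A *v y)"
    and "t\<^sub>b < t"
    and "rk_sampling M A I"
  shows "(\<integral>\<omega>. (norm (tail_average t\<^sub>b t (kaczmarz A b x0 (\<lambda>s. I s \<omega>)) - x_star))\<^sup>2 \<partial>M)
    \<le> (2 * \<kappa>\<^sup>2 - 1) / real (t - t\<^sub>b) *
       (\<kappa>\<^sup>2 * (1 - 1 / \<kappa>\<^sup>2) ^ t\<^sub>b / real (t - t\<^sub>b) * (norm (x0 - x_star))\<^sup>2
        + (spectral_norm (pinv A))\<^sup>2 * (norm (b - A *v x_star))\<^sup>2)"
proof -
  define r where "r = b - A *v x_star"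
  define e0 where "e0 = x0 - x_star"
  interpret prob_space M using assms(7) by (simp add: rk_sampling_def)
  have "x0 \<in> row_space A" using assms(5) by (simp add: row_space_def)
  moreover have "x_star \<in> row_space A" unfolding assms(3) by (rule pinv_in_row_space)
  \<comment> \<open>The choice of \<open>x_star\<close> provides both requirements: \<open>r\<close>
    is orthogonal to the range of \<open>A\<close>, and \<open>e0\<close> stays in the row
    space.\<close>
  ultimately interpret kaczmarz_residual M I A r e0
    using assms(1,7) residual_orthogonal[of b A]
    by unfold_locales
       (auto simp: rk_sampling_def r_def e0_def assms(3) intro: subspace_diff subspace_row_space)
  define n where "n = real (t - t\<^sub>b)"
  have n: "n > 0" using assms(6) by (simp add: n_def)
  have "(\<integral>\<omega>. (norm (tail_average t\<^sub>b t (kaczmarz A b x0 (\<lambda>s. I s \<omega>)) - x_star))\<^sup>2 \<partial>M) =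
      expectation (\<lambda>\<omega>. (norm (\<Sum>s\<in>{t\<^sub>b..<t}. err s \<omega>))\<^sup>2 / n\<^sup>2)"
    unfolding tail_average_diff[OF assms(6)] kaczmarz_shift r_def[symmetric] e0_def[symmetric]
    by (simp add: tail_average_def n_def power_divide)
  also have "\<dots> \<le> (2 * \<kappa>\<^sup>2 - 1) *
      (\<kappa>\<^sup>2 * (1 - 1 / \<kappa>\<^sup>2) ^ t\<^sub>b * (norm e0)\<^sup>2 + n * ((spectral_norm (pinv A))\<^sup>2 * (norm r)\<^sup>2)) / n\<^sup>2"
  proof -
    have "expectation (\<lambda>\<omega>. (norm (\<Sum>s\<in>{t\<^sub>b..<t}. err s \<omega>))\<^sup>2) \<le> (2 * \<kappa>\<^sup>2 - 1) *
      (\<kappa>\<^sup>2 * (1 - 1 / \<kappa>\<^sup>2) ^ t\<^sub>b * (norm e0)\<^sup>2 + n * ((spectral_norm (pinv A))\<^sup>2 * (norm r)\<^sup>2))"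
      \<comment> \<open>\<open>\<kappa>\<^sup>2 \<ge> 1\<close> makes the factor
        \<open>2 * \<kappa>\<^sup>2 - 1\<close> nonnegative, so the two bounds can be
        chained.\<close>
      using demmel_cond_ge_1[OF assms(1)] assms(6) unfolding assms(4) n_def
      by (intro order_trans[OF expectation_norm_sum_err_le] mult_left_mono
          sum_expectation_norm_err_le) auto
    then show ?thesis by (simp add: divide_right_mono)
  qed
  also have "\<dots> = (2 * \<kappa>\<^sup>2 - 1) / n *
      (\<kappa>\<^sup>2 * (1 - 1 / \<kappa>\<^sup>2) ^ t\<^sub>b / n * (norm e0)\<^sup>2 + (spectral_norm (pinv A))\<^sup>2 * (norm r)\<^sup>2)"
    using n by (simp add: field_simps power2_eq_square)
  finally show ?thesis unfolding n_def r_def e0_def .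
qed

end
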